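(* Let $(\nu,x_0)\in\Omega^1$ with $(\nu,x_0)\neq(2,1)$. (1) For every $n\ge2$, $K_n$ is the unique subfield of $K$ of degree $2^n$ over $\mathbb{Q}$. (2) $K$ has no proper subfield of infinite degree over $\mathbb{Q}$.
   Context: For integers $\nu\ge2$ and $x_0\ge0$, define $x_{n+1}=\pm\sqrt{\nu+x_n}$ for $n\ge0$ (any choice of sign at each step), $K_n=\mathbb{Q}(x_n)$ and $K=\bigcup_{n\ge0}K_n$. $\Omega$ is the set of pairs $(\nu,x_0)$ such that $[K_{n+1}:K_n]=2$ for every $n\ge0$ and $K$ is totally real. $\Omega^1$ is the set of $(\nu,x_0)\in\Omega$ for which the tower $(K_n)_{n\ge0}$ is not thin, i.e. some finite extension of $\mathbb{Q}$ inside $K$ is not one of the $K_n$. *)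

theory Defs
  imports Complex_Main "HOL-Algebra.Algebraic_Closure_Type" "HOL-Algebra.Generated_Fields"
begin

abbreviation CC :: "complex ring"
  where "CC \<equiv> ring_of_type_algebra"

text \<open>
  The choice of signs is a parameter \<^term>\<open>s\<close>: the \<open>n\<close>-th sign is \<open>+\<close> if \<^term>\<open>s n\<close> holds and
  \<open>-\<close> otherwise. The values live in the complex numbers because \<open>\<nu> + x\<^sub>n\<close> may be negative for
  pairs whose tower is not totally real. When every step has degree 2, changing \<^term>\<open>s\<close> only
  replaces the fields by conjugate ones, so the sets \<open>Omega s\<close> and \<open>Omega1 s\<close> do not depend on it.
\<close>

primrec tower_elt :: "(nat \<Rightarrow> bool) \<Rightarrow> int \<Rightarrow> int \<Rightarrow> nat \<Rightarrow> complex" where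
  "tower_elt s \<nu> x0 0 = of_int x0"
| "tower_elt s \<nu> x0 (Suc n) =
     (if s n then csqrt (of_int \<nu> + tower_elt s \<nu> x0 n)
      else - csqrt (of_int \<nu> + tower_elt s \<nu> x0 n))"

definition tower_field :: "(nat \<Rightarrow> bool) \<Rightarrow> int \<Rightarrow> int \<Rightarrow> nat \<Rightarrow> complex set" where
  "tower_field s \<nu> x0 n = generate_field CC (\<rat> \<union> {tower_elt s \<nu> x0 n})"

definition tower_union :: "(nat \<Rightarrow> bool) \<Rightarrow> int \<Rightarrow> int \<Rightarrow> complex set" where
  "tower_union s \<nu> x0 = (\<Union>n. tower_field s \<nu> x0 n)"

definition totally_real :: "complex set \<Rightarrow> bool" where
  "totally_real F \<longleftrightarrow> (\<forall>h \<in> ring_hom (CC\<lparr>carrier := F\<rparr>) CC. h ` F \<subseteq> \<real>)"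

definition Omega :: "(nat \<Rightarrow> bool) \<Rightarrow> (int \<times> int) set" where
  "Omega s = {(\<nu>, x0). \<nu> \<ge> 2 \<and> x0 \<ge> 0 \<and>
     (\<forall>n. ring.dimension CC 2 (tower_field s \<nu> x0 n) (tower_field s \<nu> x0 (Suc n))) \<and>
     totally_real (tower_union s \<nu> x0)}"

definition thin_tower :: "(nat \<Rightarrow> bool) \<Rightarrow> int \<Rightarrow> int \<Rightarrow> bool" where
  "thin_tower s \<nu> x0 \<longleftrightarrow>
     (\<forall>F. subfield F CC \<and> F \<subseteq> tower_union s \<nu> x0 \<and> ring.finite_dimension CC \<rat> F
        \<longrightarrow> (\<exists>n. F = tower_field s \<nu> x0 n))"

definition Omega1 :: "(nat \<Rightarrow> bool) \<Rightarrow> (int \<times> int) set" where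
  "Omega1 s = {(\<nu>, x0) \<in> Omega s. \<not> thin_tower s \<nu> x0}"

end

theory Submission
  imports Defs
begin

text \<open>
  The extension \<open>K\<^bsub>m+2\<^esub>/K\<^sub>m\<close> is biquadratic iff \<open>\<nu>\<^sup>2 - \<nu> - x\<^sub>m\<close> is a square in \<open>K\<^sub>m\<close>. Taking
  norms down to \<open>\<rat>\<close>, this makes \<open>c\<^sub>m - x\<^sub>0\<close> a perfect square, where \<open>c\<^sub>0 = \<nu>\<^sup>2 - \<nu>\<close> and
  \<open>c\<^bsub>k+1\<^esub> = c\<^sub>k\<^sup>2 - \<nu>\<close>. Total reality gives \<open>x\<^sub>0 < \<nu>\<^sup>2 - \<nu>\<close>, and then for \<open>m \<ge> 1\<close> the number
  \<open>c\<^sub>m - x\<^sub>0 = c\<^bsub>m-1\<^esub>\<^sup>2 - (\<nu> + x\<^sub>0)\<close> lies strictly between consecutive squares unless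
  \<open>(\<nu>, x\<^sub>0) = (2, 1)\<close>. So only the bottom step can be biquadratic.

  It follows that every subfield \<open>F\<close> of \<open>K\<^bsub>n+1\<^esub>\<close> with \<open>n \<ge> 2\<close> that is not contained in \<open>K\<^sub>n\<close> equals
  \<open>K\<^bsub>n+1\<^esub>\<close>: otherwise some \<open>F K\<^sub>i\<close> has index 2 in \<open>K\<^bsub>n+1\<^esub>\<close> and does not contain \<open>x\<^bsub>i+1\<^esub>\<close>, and the
  involution \<open>\<tau>\<close> over \<open>F K\<^sub>i\<close> yields the square root \<open>x\<^bsub>i+2\<^esub> \<tau>(x\<^bsub>i+2\<^esub>)\<close> of \<open>\<nu>\<^sup>2 - \<nu> - x\<^sub>i\<close>; this
  forces \<open>i = 0\<close>, and repeating the argument with \<open>x\<^sub>3 \<tau>(x\<^sub>3)\<close> makes \<open>c\<^sub>1 - x\<^sub>0\<close> a square. Both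
  claims about subfields of \<open>K\<close> are consequences.
\<close>

section \<open>Subfields of the complex numbers\<close>

lemma CC_simps [simp]:
  "carrier CC = UNIV" "monoid.mult CC = (*)" "one CC = 1" "ring.zero CC = 0" "add CC = (+)"
  by (auto simp: ring_of_type_algebra_def)

interpretation CC: cring CC
  by (rule cring_from_type_algebra)

lemma field_CC: "field CC"
  by (rule field_from_type_algebra)

lemma CC_a_inv [simp]: "\<ominus>\<^bsub>CC\<^esub> a = - a"
  by (rule CC.minus_equality) auto

lemma CC_m_inv: "a \<noteq> 0 \<Longrightarrow> inv\<^bsub>CC\<^esub> a = inverse a"
  by (rule CC.comm_inv_char) auto

lemma subfield_CC_I:
  assumes "1 \<in> k" "\<And>a b. a \<in> k \<Longrightarrow> b \<in> k \<Longrightarrow> a + b \<in> k" "\<And>a. a \<in> k \<Longrightarrow> - a \<in> k"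
    "\<And>a b. a \<in> k \<Longrightarrow> b \<in> k \<Longrightarrow> a * b \<in> k" "\<And>a. a \<in> k \<Longrightarrow> a \<noteq> 0 \<Longrightarrow> inverse a \<in> k"
  shows "subfield k CC"
  by (rule field.subfieldI'[OF field_CC], rule CC.subringI) (use assms in \<open>auto simp: CC_m_inv\<close>)

context
  fixes k assumes k: "subfield k CC"
begin

lemma subfield_one: "1 \<in> k"
  using subringE(3)[OF subfieldE(1)[OF k]] by simp

lemma subfield_zero: "0 \<in> k"
  using subringE(2)[OF subfieldE(1)[OF k]] by simp

lemma subfield_add: "a \<in> k \<Longrightarrow> b \<in> k \<Longrightarrow> a + b \<in> k"
  using subringE(7)[OF subfieldE(1)[OF k]] by simp

lemma subfield_uminus: "a \<in> k \<Longrightarrow> - a \<in> k"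
  using subringE(5)[OF subfieldE(1)[OF k], of a] by simp

lemma subfield_diff: "a \<in> k \<Longrightarrow> b \<in> k \<Longrightarrow> a - b \<in> k"
  using subfield_add[of a "- b"] subfield_uminus[of b] by simp

lemma subfield_mult: "a \<in> k \<Longrightarrow> b \<in> k \<Longrightarrow> a * b \<in> k"
  using subringE(6)[OF subfieldE(1)[OF k]] by simp

lemma subfield_power: "a \<in> k \<Longrightarrow> a ^ n \<in> k"
  by (induction n) (auto intro: subfield_one subfield_mult)

lemma subfield_inverse: "a \<in> k \<Longrightarrow> inverse a \<in> k"
  using CC.subfield_m_inv(1)[OF k, of a] by (cases "a = 0") (auto simp: CC_m_inv)

lemma subfield_divide: "a \<in> k \<Longrightarrow> b \<in> k \<Longrightarrow> a / b \<in> k"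
  by (simp add: divide_inverse subfield_mult subfield_inverse)

lemma subfield_of_nat: "of_nat n \<in> k"
  by (induction n) (auto intro: subfield_zero subfield_one subfield_add)

lemma subfield_of_int: "of_int i \<in> k"
  by (cases i) (auto intro: subfield_of_nat subfield_diff subfield_uminus subfield_one simp del: of_nat_Suc)

lemma subfield_numeral: "numeral i \<in> k"
  using subfield_of_nat[of "numeral i"] by simp

lemma Rats_subset_subfield: "\<rat> \<subseteq> k"
  by (auto elim!: Rats_cases' intro!: subfield_divide subfield_of_int)

end

lemmas subfield_intros = subfield_one subfield_zero subfield_add subfield_uminus subfield_diff
  subfield_mult subfield_power subfield_inverse subfield_divide subfield_of_int subfield_numeral

lemma subfield_Rats: "subfield \<rat> CC"
  by (rule subfield_CC_I) auto

lemma ring_hom_CC_iff: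
  "h \<in> ring_hom (CC\<lparr>carrier := k\<rparr>) CC \<longleftrightarrow>
     (\<forall>a\<in>k. \<forall>b\<in>k. h (a * b) = h a * h b \<and> h (a + b) = h a + h b) \<and> h 1 = 1"
  by (auto simp: ring_hom_def)

section \<open>Quadratic extensions\<close>

text \<open>Applied with \<open>x\<^sup>2 \<in> k\<close>, where this set is the field
  \<open>k(x)\<close>; if \<open>x \<in> k\<close>, it is \<open>k\<close> itself.\<close>

definition adj :: "complex set \<Rightarrow> complex \<Rightarrow> complex set" where
  "adj k x = {a + b * x | a b. a \<in> k \<and> b \<in> k}"

text \<open>
  The extension of \<open>h\<close> to \<open>k(x)\<close> that sends \<open>x\<close> to \<open>x'\<close>. Meaningful only if \<open>x \<notin> k\<close>, when the
  coordinates \<open>a\<close>, \<open>b\<close> of \<open>y\<close> are unique.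
\<close>

definition ext :: "(complex \<Rightarrow> complex) \<Rightarrow> complex set \<Rightarrow> complex \<Rightarrow> complex \<Rightarrow> complex \<Rightarrow> complex" where
  "ext h k x x' y = (THE c. \<exists>a\<in>k. \<exists>b\<in>k. y = a + b * x \<and> c = h a + h b * x')"

lemma adjI: "a \<in> k \<Longrightarrow> b \<in> k \<Longrightarrow> a + b * x \<in> adj k x"
  by (auto simp: adj_def)

lemma adjE:
  assumes "y \<in> adj k x"
  obtains a b where "a \<in> k" "b \<in> k" "y = a + b * x"
  using assms by (auto simp: adj_def)

context
  fixes k x assumes k: "subfield k CC" and sq: "x\<^sup>2 \<in> k"
begin

lemma subset_adj: "k \<subseteq> adj k x"
  using adjI[of _ k 0 x] subfield_zero[OF k] by auto

lemma gen_in_adj: "x \<in> adj k x"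
  using adjI[of 0 k 1 x] subfield_zero[OF k] subfield_one[OF k] by auto

lemma adj_mult_eq: "(a + b * x) * (c + d * x) = (a * c + b * d * x\<^sup>2) + (a * d + b * c) * x"
  by (simp add: algebra_simps power2_eq_square)

lemma subfield_adj: "subfield (adj k x) CC"
proof (cases "x \<in> k")
  case True
  then have "adj k x = k"
    using subset_adj by (auto elim!: adjE intro!: subfield_intros[OF k])
  then show ?thesis using k by simp
next
  case False
  show ?thesis
  proof (rule subfield_CC_I)
    show "1 \<in> adj k x" using subset_adj subfield_one[OF k] by blast
  next
    fix u v assume uv: "u \<in> adj k x" "v \<in> adj k x"
    obtain a b where u: "a \<in> k" "b \<in> k" "u = a + b * x" using uv(1) by (rule adjE)
    obtain c d where v: "c \<in> k" "d \<in> k" "v = c + d * x" using uv(2) by (rule adjE)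
    note * = u v
    have add: "u + v = (a + c) + (b + d) * x" using * by (simp add: algebra_simps)
    show "u + v \<in> adj k x"
      unfolding add by (rule adjI) (use * in \<open>auto intro!: subfield_intros[OF k]\<close>)
    have mult: "u * v = (a * c + b * d * x\<^sup>2) + (a * d + b * c) * x" unfolding * by (rule adj_mult_eq)
    show "u * v \<in> adj k x"
      unfolding mult by (rule adjI) (use * sq in \<open>auto intro!: subfield_intros[OF k]\<close>)
  next
    fix u assume "u \<in> adj k x"
    then obtain a b where *: "a \<in> k" "b \<in> k" "u = a + b * x" by (auto elim!: adjE)
    have "- u = - a + (- b) * x" using * by simp
    then show "- u \<in> adj k x" using * by (metis adjI subfield_uminus[OF k])
    assume "u \<noteq> 0"
    define n where "n = a\<^sup>2 - b\<^sup>2 * x\<^sup>2"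
    have n: "n \<in> k" using * sq by (auto simp: n_def intro!: subfield_intros[OF k])
    have "a - b * x \<noteq> 0"
    proof
      assume "a - b * x = 0"
      then have "b \<noteq> 0" using \<open>u \<noteq> 0\<close> * by auto
      with \<open>a - b * x = 0\<close> have "x = a / b" by (simp add: field_simps)
      then show False using False * subfield_divide[OF k] by simp
    qed
    moreover have nu: "n = u * (a - b * x)"
      by (simp add: n_def * algebra_simps power2_eq_square)
    ultimately have "n \<noteq> 0" using \<open>u \<noteq> 0\<close> by simp
    with nu \<open>u \<noteq> 0\<close> have "inverse u = (a - b * x) / n" by (simp add: divide_simps)
    also have "\<dots> = a / n + (- b / n) * x" by (simp add: diff_divide_distrib)
    finally have inv: "inverse u = a / n + (- b / n) * x" .
    show "inverse u \<in> adj k x"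
      unfolding inv by (rule adjI) (use * n in \<open>auto intro!: subfield_intros[OF k]\<close>)
  qed
qed

lemma adj_subset: "subfield L CC \<Longrightarrow> k \<subseteq> L \<Longrightarrow> x \<in> L \<Longrightarrow> adj k x \<subseteq> L"
  by (auto elim!: adjE intro!: subfield_intros)

context
  assumes x: "x \<notin> k"
begin

lemma adj_coords_unique:
  assumes "a \<in> k" "b \<in> k" "c \<in> k" "d \<in> k" "a + b * x = c + d * x"
  shows "a = c \<and> b = d"
proof -
  have *: "(b - d) * x = c - a" using assms(5) by (simp add: algebra_simps)
  have "b = d"
  proof (rule ccontr)
    assume "b \<noteq> d"
    with * have "x = (c - a) / (b - d)" by (simp add: field_simps)
    then show False using x assms by (metis subfield_diff[OF k] subfield_divide[OF k])
  qed
  with * show ?thesis by simp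
qed

lemma ext_eq:
  assumes "a \<in> k" "b \<in> k"
  shows "ext h k x x' (a + b * x) = h a + h b * x'"
  unfolding ext_def
proof (rule the_equality)
  fix c assume "\<exists>a'\<in>k. \<exists>b'\<in>k. a + b * x = a' + b' * x \<and> c = h a' + h b' * x'"
  then show "c = h a + h b * x'" using adj_coords_unique assms by metis
qed (use assms in auto)

lemma ext_base: "h 0 = 0 \<Longrightarrow> a \<in> k \<Longrightarrow> ext h k x x' a = h a"
  using ext_eq[of a 0] subfield_zero[OF k] by simp

lemma ext_gen: "h 0 = 0 \<Longrightarrow> h 1 = 1 \<Longrightarrow> ext h k x x' x = x'"
  using ext_eq[of 0 1] subfield_zero[OF k] subfield_one[OF k] by simp

lemma ring_hom_ext:
  assumes h: "h \<in> ring_hom (CC\<lparr>carrier := k\<rparr>) CC" and x': "x'\<^sup>2 = h (x\<^sup>2)"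
  shows "ext h k x x' \<in> ring_hom (CC\<lparr>carrier := adj k x\<rparr>) CC"
proof -
  have hm: "h (a * b) = h a * h b" "h (a + b) = h a + h b" if "a \<in> k" "b \<in> k" for a b
    using h that by (auto simp: ring_hom_CC_iff)
  have h1: "h 1 = 1" using h by (auto simp: ring_hom_CC_iff)
  have h0: "h 0 = 0" using hm(2)[of 0 0] subfield_zero[OF k] by simp
  have "ext h k x x' (u * v) = ext h k x x' u * ext h k x x' v
      \<and> ext h k x x' (u + v) = ext h k x x' u + ext h k x x' v"
    if uv: "u \<in> adj k x" "v \<in> adj k x" for u v
  proof -
    obtain a b where u: "a \<in> k" "b \<in> k" "u = a + b * x" using uv(1) by (rule adjE)
    obtain c d where v: "c \<in> k" "d \<in> k" "v = c + d * x" using uv(2) by (rule adjE)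
    note * = u v
    have eq: "u + v = (a + c) + (b + d) * x" using * by (simp add: algebra_simps)
    have eq2: "u * v = (a * c + b * d * x\<^sup>2) + (a * d + b * c) * x" unfolding * by (rule adj_mult_eq)
    note in_k = subfield_add[OF k] subfield_mult[OF k]
    have "ext h k x x' (u + v) = h (a + c) + h (b + d) * x'"
      unfolding eq by (rule ext_eq) (use * in \<open>auto intro!: in_k\<close>)
    moreover have "ext h k x x' (u * v) = h (a * c + b * d * x\<^sup>2) + h (a * d + b * c) * x'"
      unfolding eq2 by (rule ext_eq) (use * sq in \<open>auto intro!: in_k\<close>)
    moreover have "ext h k x x' u = h a + h b * x'" "ext h k x x' v = h c + h d * x'"
      using * by (auto intro: ext_eq)
    moreover have "h (a * c + b * d * x\<^sup>2) = h a * h c + h b * h d * x'\<^sup>2"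
      "h (a * d + b * c) = h a * h d + h b * h c"
      using * sq by (simp_all add: hm in_k x')
    ultimately show ?thesis
      using * by (simp add: hm algebra_simps power2_eq_square)
  qed
  then show ?thesis
    using ext_base[of h 1 x'] subfield_one[OF k] h0 h1 by (auto simp: ring_hom_CC_iff)
qed

end

lemma quadratic_conj_exists:
  assumes x: "x \<notin> k"
  obtains \<tau> where "\<tau> \<in> ring_hom (CC\<lparr>carrier := adj k x\<rparr>) CC" "\<And>y. y \<in> adj k x \<Longrightarrow> \<tau> y \<in> adj k x"
    "\<And>y. y \<in> adj k x \<Longrightarrow> \<tau> (\<tau> y) = y" "\<And>y. y \<in> k \<Longrightarrow> \<tau> y = y" "\<tau> x = - x"
proof
  let ?t = "ext (\<lambda>a. a) k x (- x)"
  show "?t \<in> ring_hom (CC\<lparr>carrier := adj k x\<rparr>) CC"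
    by (rule ring_hom_ext[OF x]) (auto simp: ring_hom_CC_iff)
  have eq: "?t (a + b * x) = a + (- b) * x" if "a \<in> k" "b \<in> k" for a b
    using ext_eq[OF x that, of "\<lambda>a. a" "- x"] by simp
  show "?t y \<in> adj k x" "?t (?t y) = y" if y: "y \<in> adj k x" for y
  proof -
    obtain a b where *: "a \<in> k" "b \<in> k" "y = a + b * x" using y by (rule adjE)
    have b: "- b \<in> k" using * subfield_uminus[OF k] by blast
    show "?t y \<in> adj k x" using * b by (simp only: eq adjI)
    show "?t (?t y) = y" using * b eq[of a "- b"] eq[of a b] by simp
  qed
  show "?t y = y" if "y \<in> k" for y using ext_base[OF x _ that] by simp
  show "?t x = - x" using ext_gen[OF x] by simp
qed

text \<open>The \<open>x\<close>-coordinate of \<open>y\<^sup>2\<close> is \<open>2 * a * b\<close>;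
  it must vanish, while \<open>b\<close> cannot.\<close>

lemma square_in_base_imp_multiple:
  assumes x: "x \<notin> k" and y: "y \<in> adj k x" "y \<notin> k" "y\<^sup>2 \<in> k"
  obtains b where "b \<in> k" "b \<noteq> 0" "y = b * x"
proof -
  obtain a b where *: "a \<in> k" "b \<in> k" "y = a + b * x" using y(1) by (rule adjE)
  have b: "b \<noteq> 0" using * y(2) by auto
  have "y\<^sup>2 + 0 * x = (a * a + b * b * x\<^sup>2) + (a * b + b * a) * x"
    using adj_mult_eq[of a b a b] * by (simp add: power2_eq_square)
  moreover have "a * a + b * b * x\<^sup>2 \<in> k" "a * b + b * a \<in> k"
    using * sq by (auto intro!: subfield_intros[OF k])
  ultimately have "a * b + b * a = 0"
    using adj_coords_unique[OF x y(3) subfield_zero[OF k]] by metis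
  then have "a = 0" using b by (simp add: mult.commute)
  then show ?thesis using that * b by auto
qed

end

section \<open>Towers of square roots\<close>

text \<open>Chosen so that \<open>iter_norm \<nu> (j + 1) - x n\<close> is the norm of
  \<open>iter_norm \<nu> j - x (n + 1)\<close> from \<open>K (n + 1)\<close> to
  \<open>K n\<close>.\<close>

primrec iter_norm :: "int \<Rightarrow> nat \<Rightarrow> int" where
  "iter_norm \<nu> 0 = \<nu>\<^sup>2 - \<nu>"
| "iter_norm \<nu> (Suc k) = (iter_norm \<nu> k)\<^sup>2 - \<nu>"

text \<open>Only the squares of the generators are prescribed, so every choice of signs is
  covered.\<close>

locale sqrt_tower =
  fixes \<nu> x0 :: int and x :: "nat \<Rightarrow> complex" and K :: "nat \<Rightarrow> complex set"
  assumes x_0: "x 0 = of_int x0"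
    and x_Suc_sq: "(x (Suc n))\<^sup>2 = of_int \<nu> + x n"
    and K_0: "K 0 = \<rat>"
    and K_Suc: "K (Suc n) = adj (K n) (x (Suc n))"
    and x_Suc_notin: "x (Suc n) \<notin> K n"
begin

lemma subfield_K: "subfield (K n) CC" and x_in_K: "x n \<in> K n"
proof -
  have "subfield (K n) CC \<and> x n \<in> K n"
  proof (induction n)
    case 0
    then show ?case by (simp add: K_0 x_0 subfield_Rats)
  next
    case (Suc n)
    then have "(x (Suc n))\<^sup>2 \<in> K n"
      unfolding x_Suc_sq by (auto intro!: subfield_intros)
    then show ?case unfolding K_Suc using Suc subfield_adj gen_in_adj by blast
  qed
  then show "subfield (K n) CC" "x n \<in> K n" by auto
qed

lemma x_Suc_sq_in: "(x (Suc n))\<^sup>2 \<in> K n"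
  unfolding x_Suc_sq by (auto intro!: subfield_intros subfield_K x_in_K)

lemmas K_intros = subfield_intros[OF subfield_K]

lemma K_mono: "m \<le> n \<Longrightarrow> K m \<subseteq> K n"
  by (rule lift_Suc_mono_le[of K]) (auto simp: K_Suc intro: subset_adj[OF subfield_K x_Suc_sq_in, THEN subsetD])

lemma K_SucE:
  assumes "y \<in> K (Suc n)"
  obtains a b where "a \<in> K n" "b \<in> K n" "y = a + b * x (Suc n)"
  using assms unfolding K_Suc by (rule adjE)

lemmas coords_unique = adj_coords_unique[OF subfield_K x_Suc_sq_in x_Suc_notin]

lemma entry_level:
  assumes "y \<in> K n" "y \<notin> K j"
  obtains m where "j \<le> m" "m < n" "y \<in> K (Suc m)" "y \<notin> K m"
proof -
  define m where "m = (LEAST i. y \<in> K i)"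
  have m: "y \<in> K m" unfolding m_def using assms(1) by (rule LeastI)
  have least: "y \<notin> K i" if "i < m" for i using that not_less_Least unfolding m_def by blast
  have "j < m" using m assms(2) K_mono[of m j] by (meson not_le_imp_less subsetD)
  moreover have "m \<le> n" unfolding m_def using assms(1) by (rule Least_le)
  ultimately show ?thesis using that[of "m - 1"] m least[of "m - 1"] by auto
qed

text \<open>The root \<open>r\<close> is the norm of \<open>q\<close>, because the right-hand side
  is the norm of \<open>c - x (Suc n)\<close>.\<close>

lemma norm_descent:
  assumes "c \<in> K n" "q \<in> K (Suc n)" "q\<^sup>2 = c - x (Suc n)"
  shows "\<exists>r\<in>K n. r\<^sup>2 = c\<^sup>2 - of_int \<nu> - x n"
proof -
  obtain a b where q: "a \<in> K n" "b \<in> K n" "q = a + b * x (Suc n)" using assms(2) by (rule K_SucE)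
  let ?X = "of_int \<nu> + x n"
  have X: "?X \<in> K n" using x_Suc_sq_in[of n] x_Suc_sq by simp
  have "(a\<^sup>2 + b\<^sup>2 * ?X) + (2 * a * b) * x (Suc n) = c + (- 1) * x (Suc n)"
    using assms(3) unfolding q x_Suc_sq[symmetric] by (simp add: algebra_simps power2_eq_square)
  then have *: "a\<^sup>2 + b\<^sup>2 * ?X = c" "2 * a * b = - 1"
    using coords_unique[of "a\<^sup>2 + b\<^sup>2 * ?X" n "2 * a * b" c "- 1"] q X assms(1)
    by (auto intro!: K_intros)
  have "(a\<^sup>2 - b\<^sup>2 * ?X)\<^sup>2 = (a\<^sup>2 + b\<^sup>2 * ?X)\<^sup>2 - (2 * a * b)\<^sup>2 * ?X"
    by (simp add: algebra_simps power2_eq_square)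
  then have "(a\<^sup>2 - b\<^sup>2 * ?X)\<^sup>2 = c\<^sup>2 - of_int \<nu> - x n" unfolding * by simp
  moreover have "a\<^sup>2 - b\<^sup>2 * ?X \<in> K n" using q X by (auto intro!: K_intros)
  ultimately show ?thesis by blast
qed

text \<open>
  \<open>\<nu>\<^sup>2 - \<nu> - x\<^sub>m\<close> is the norm of \<open>\<nu> + x\<^bsub>m+1\<^esub>\<close> from \<open>K\<^bsub>m+1\<^esub>\<close> to \<open>K\<^sub>m\<close>; it is a square exactly when
  \<open>K\<^bsub>m+2\<^esub>/K\<^sub>m\<close> is biquadratic.
\<close>

lemma new_sqrt_imp_norm_square:
  assumes z: "z \<in> K (Suc (Suc m))" "z \<notin> K (Suc m)" "z\<^sup>2 \<in> K m"
  shows "\<exists>q\<in>K m. q\<^sup>2 = (of_int \<nu>)\<^sup>2 - of_int \<nu> - x m"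
proof -
  have "z\<^sup>2 \<in> K (Suc m)" using z(3) K_mono[of m "Suc m"] by auto
  then obtain b where b: "b \<in> K (Suc m)" "b \<noteq> 0" "z = b * x (Suc (Suc m))"
    using square_in_base_imp_multiple[OF subfield_K x_Suc_sq_in x_Suc_notin _ z(2)] z(1)
    unfolding K_Suc[of "Suc m"] by metis
  obtain p q where pq: "p \<in> K m" "q \<in> K m" "b = p + q * x (Suc m)" using b(1) by (rule K_SucE)
  let ?x = "x (Suc m)"
  let ?X = "of_int \<nu> + x m" and ?\<nu> = "of_int \<nu> :: complex"
  have X: "?X \<in> K m" using x_Suc_sq_in[of m] x_Suc_sq by simp
  define P Q where "P = p\<^sup>2 + q\<^sup>2 * ?X" and "Q = 2 * p * q"
  have PQ: "P \<in> K m" "Q \<in> K m" using pq X by (auto simp: P_def Q_def intro!: K_intros)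
  have xx: "?x * ?x = ?X" using x_Suc_sq[of m] by (simp add: power2_eq_square)
  have b2: "b\<^sup>2 = P + Q * ?x"
    unfolding P_def Q_def pq xx[symmetric] by (simp add: algebra_simps power2_eq_square)
  have "z\<^sup>2 + 0 * ?x = (P + Q * ?x) * (?\<nu> + ?x)"
    unfolding b power_mult_distrib x_Suc_sq b2 by simp
  also have "\<dots> = (P * ?\<nu> + Q * (?x * ?x)) + (P + Q * ?\<nu>) * ?x"
    by (simp add: algebra_simps)
  finally have "z\<^sup>2 + 0 * ?x = (P * ?\<nu> + Q * ?X) + (P + Q * ?\<nu>) * ?x" unfolding xx .
  then have "P + Q * ?\<nu> = 0"
    using coords_unique[of "z\<^sup>2" m 0 "P * ?\<nu> + Q * ?X" "P + Q * ?\<nu>"] PQ X z(3)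
    by (auto intro!: K_intros)
  then have P: "P = - Q * ?\<nu>" by (simp add: algebra_simps eq_neg_iff_add_eq_0)
  have Q: "Q \<noteq> 0" using b2 P b(2) by auto
  \<comment> \<open>Both sides are the norm of \<open>b\<^sup>2\<close>; substituting for
    \<open>P\<close> exhibits \<open>\<nu>\<^sup>2 - ?X\<close> as a square.\<close>
  have "(p\<^sup>2 - q\<^sup>2 * ?X)\<^sup>2 = P\<^sup>2 - Q\<^sup>2 * ?X"
    unfolding P_def Q_def by (simp add: algebra_simps power2_eq_square)
  also have "\<dots> = Q\<^sup>2 * (?\<nu>\<^sup>2 - ?X)" unfolding P by (simp add: algebra_simps power2_eq_square)
  finally have "((p\<^sup>2 - q\<^sup>2 * ?X) / Q)\<^sup>2 = ?\<nu>\<^sup>2 - ?X"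
    using Q by (simp add: power_divide)
  then have "((p\<^sup>2 - q\<^sup>2 * ?X) / Q)\<^sup>2 = ?\<nu>\<^sup>2 - ?\<nu> - x m" by (simp only: diff_diff_eq)
  moreover have "(p\<^sup>2 - q\<^sup>2 * ?X) / Q \<in> K m" using pq X PQ by (auto intro!: K_intros)
  ultimately show ?thesis by blast
qed

text \<open>Each use of \<open>norm_descent\<close> lowers \<open>m\<close> by one and raises
  \<open>j\<close> by one, until the rationals are reached.\<close>

lemma square_descent:
  assumes "q \<in> K m" "q\<^sup>2 = of_int (iter_norm \<nu> j) - x m"
  shows "\<exists>r\<in>\<rat>. r\<^sup>2 = (of_int (iter_norm \<nu> (m + j) - x0) :: complex)"
  using assms
proof (induction m arbitrary: j q)
  case 0
  then show ?case by (auto simp: K_0 x_0)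
next
  case (Suc m)
  then obtain r where "r \<in> K m" "r\<^sup>2 = (of_int (iter_norm \<nu> j))\<^sup>2 - of_int \<nu> - x m"
    using norm_descent[of "of_int (iter_norm \<nu> j)" m q] subfield_of_int[OF subfield_K] by blast
  then show ?case using Suc.IH[of r "Suc j"] by simp
qed

end

section \<open>Subfields of a tower that is biquadratic at most at the bottom\<close>

locale rigid_sqrt_tower = sqrt_tower +
  assumes iter_norm_nonsquare: "1 \<le> m \<Longrightarrow> r \<in> \<rat> \<Longrightarrow> r\<^sup>2 \<noteq> (of_int (iter_norm \<nu> m - x0) :: complex)"
begin

text \<open>Descent from \<open>j = 0\<close> contradicts the locale assumption. Level
  \<open>0\<close> is exempt, since \<open>K 2\<close> may be biquadratic over the
  rationals.\<close>

lemma norm_nonsquare: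
  assumes "1 \<le> m" "q \<in> K m"
  shows "q\<^sup>2 \<noteq> (of_int \<nu>)\<^sup>2 - of_int \<nu> - x m"
  using square_descent[of q m 0] iter_norm_nonsquare[of m] assms by auto

text \<open>At the level where \<open>z\<close> first appears, its square lies two levels below, so
  that double step is biquadratic; by \<open>norm_nonsquare\<close> it is the bottom one.\<close>

lemma new_sqrt_imp_bottom:
  assumes "z \<in> K n" "z \<notin> K (Suc j)" "z\<^sup>2 \<in> K j"
  shows "j = 0 \<and> (\<exists>q\<in>\<rat>. q\<^sup>2 = (of_int \<nu>)\<^sup>2 - of_int \<nu> - x 0)"
proof -
  obtain m where m: "Suc j \<le> m" "z \<in> K (Suc m)" "z \<notin> K m" using assms(1,2) by (rule entry_level)
  then obtain m' where m': "m = Suc m'" "j \<le> m'" by (cases m) auto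
  have "z\<^sup>2 \<in> K m'" using assms(3) K_mono[OF m'(2)] by auto
  then obtain q where q: "q \<in> K m'" "q\<^sup>2 = (of_int \<nu>)\<^sup>2 - of_int \<nu> - x m'"
    using new_sqrt_imp_norm_square m m' by blast
  then have "m' = 0" using norm_nonsquare[of m' q] by (cases m') auto
  then show ?thesis using q m' K_0 by auto
qed

text \<open>
  The product \<open>z = x\<^bsub>i+2\<^esub> \<tau>(x\<^bsub>i+2\<^esub>)\<close> is \<open>\<tau>\<close>-invariant and a square root of \<open>\<nu>\<^sup>2 - \<nu> - x\<^sub>i\<close>, which
  forces \<open>i = 0\<close> and \<open>z\<close> rational; then \<open>w = x\<^sub>3 \<tau>(x\<^sub>3)\<close> lies in \<open>K\<^sub>2\<close>, and its norm to \<open>K\<^sub>1\<close>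
  is a rational square root of \<open>(\<nu>\<^sup>2 - \<nu>)\<^sup>2 - \<nu> - x\<^sub>0\<close>.
\<close>

lemma no_involution:
  assumes n: "2 \<le> n" and i: "i < n"
    and \<tau>: "\<tau> \<in> ring_hom (CC\<lparr>carrier := K (Suc n)\<rparr>) CC" "\<And>y. y \<in> K (Suc n) \<Longrightarrow> \<tau> y \<in> K (Suc n)"
      "\<And>y. y \<in> K (Suc n) \<Longrightarrow> \<tau> (\<tau> y) = y" "\<And>y. y \<in> K i \<Longrightarrow> \<tau> y = y" "\<tau> (x (Suc i)) = - x (Suc i)"
  shows False
proof -
  let ?\<nu> = "of_int \<nu> :: complex"
  have inL: "y \<in> K (Suc n)" if "y \<in> K m" "m \<le> Suc n" for y m using K_mono[OF that(2)] that(1) by auto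
  have \<tau>_mult: "\<tau> (a * b) = \<tau> a * \<tau> b" and \<tau>_add: "\<tau> (a + b) = \<tau> a + \<tau> b"
    if "a \<in> K (Suc n)" "b \<in> K (Suc n)" for a b
    using \<tau>(1) that by (auto simp: ring_hom_CC_iff)
  have \<tau>_Rats: "\<tau> a = a" if "a \<in> \<rat>" for a
    using that \<tau>(4) Rats_subset_subfield[OF subfield_K] by blast
  have \<tau>_int: "\<tau> (of_int a) = of_int a" for a by (rule \<tau>_Rats) auto
  have \<tau>_sq: "\<tau> (a\<^sup>2) = (\<tau> a)\<^sup>2" if "a \<in> K (Suc n)" for a
    using \<tau>_mult[OF that that] by (simp add: power2_eq_square)
  have xL: "x m \<in> K (Suc n)" if "m \<le> Suc n" for m using inL[OF x_in_K that] .
  have \<nu>L: "?\<nu> \<in> K (Suc n)" by (rule subfield_of_int[OF subfield_K])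

  define y where "y = x (Suc (Suc i))"
  have yL: "y \<in> K (Suc n)" unfolding y_def using xL i by simp
  have y2: "y\<^sup>2 = ?\<nu> + x (Suc i)" unfolding y_def x_Suc_sq ..
  have \<tau>y2: "(\<tau> y)\<^sup>2 = ?\<nu> - x (Suc i)"
    using \<tau>_sq[OF yL] unfolding y2 using \<tau>_add[OF \<nu>L xL[of "Suc i"]] i \<tau>(5) \<tau>_int by simp
  define z where "z = y * \<tau> y"
  have zL: "z \<in> K (Suc n)" unfolding z_def using yL \<tau>(2) by (auto intro!: K_intros)
  have \<tau>z: "\<tau> z = z" unfolding z_def using yL \<tau>(2,3) by (simp add: \<tau>_mult mult.commute)
  have z2: "z\<^sup>2 = ?\<nu>\<^sup>2 - ?\<nu> - x i"
  proof -
    have "z\<^sup>2 = (?\<nu> + x (Suc i)) * (?\<nu> - x (Suc i))"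
      unfolding z_def power_mult_distrib y2 \<tau>y2 ..
    also have "\<dots> = ?\<nu>\<^sup>2 - (x (Suc i))\<^sup>2" by (simp add: algebra_simps power2_eq_square)
    finally show ?thesis by (simp add: x_Suc_sq)
  qed
  have z2i: "z\<^sup>2 \<in> K i" unfolding z2 by (auto intro!: K_intros x_in_K)
  have "z \<in> K i"
  proof (rule ccontr)
    assume zi: "z \<notin> K i"
    show False
    proof (cases "z \<in> K (Suc i)")
      case True
      then obtain b where b: "b \<in> K i" "b \<noteq> 0" "z = b * x (Suc i)"
        using square_in_base_imp_multiple[OF subfield_K x_Suc_sq_in x_Suc_notin _ zi z2i]
        unfolding K_Suc by metis
      \<comment> \<open>Being also fixed by \<open>\<tau>\<close>, such a \<open>z\<close> would be
        zero.\<close>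
      then have "\<tau> z = - z" using \<tau>_mult[OF inL[OF b(1)] xL[of "Suc i"]] i \<tau>(4,5) by simp
      then show False using \<tau>z zi subfield_zero[OF subfield_K] by auto
    next
      case False
      then have "i = 0 \<and> (\<exists>q\<in>\<rat>. q\<^sup>2 = z\<^sup>2)"
        using new_sqrt_imp_bottom[OF zL False z2i] z2 by auto
      then show False using zi K_0 by (auto simp: power2_eq_iff)
    qed
  qed
  then have i0: "i = 0" using norm_nonsquare[of i z] z2 by (cases i) auto
  have zQ: "z \<in> \<rat>" using \<open>z \<in> K i\<close> i0 K_0 by simp

  have y: "y = x 2" and yK: "y \<in> K 2" "y \<notin> K 1" and y2': "y\<^sup>2 \<in> K 1"
    using x_in_K[of 2] x_Suc_notin[of 1] x_Suc_sq_in[of 1] by (auto simp: y_def i0 eval_nat_numeral)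
  have y0: "y \<noteq> 0" using yK(2) subfield_zero[OF subfield_K] by auto
  have \<tau>y: "\<tau> y = z / y" using y0 by (simp add: z_def)
  have zK: "z \<in> K m" for m using zQ Rats_subset_subfield[OF subfield_K] by blast
  have K2: "K 2 = adj (K 1) y" using K_Suc[of 1] by (simp add: y eval_nat_numeral)
  have K1: "K 1 = adj (K 0) (x 1)" using K_Suc[of 0] by simp
  \<comment> \<open>\<open>\<tau>\<close> negates \<open>x 1\<close> and sends \<open>y\<close> to
    \<open>z / y\<close> with \<open>z\<close> rational, so it preserves \<open>K 1\<close> and
    \<open>K 2\<close>.\<close>
  have \<tau>K1: "\<tau> a \<in> K 1" if a: "a \<in> K 1" for a
  proof -
    obtain p q where pq: "p \<in> K 0" "q \<in> K 0" "a = p + q * x 1" using a unfolding K1 by (rule adjE)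
    then have "\<tau> a = p - q * x 1"
      using \<tau>_mult[of q "x 1"] \<tau>_add[of p "q * x 1"] inL[of _ 0] xL[of 1] \<tau>(4,5) i0
      by (auto intro!: K_intros)
    then show ?thesis using pq K_mono[of 0 1] x_in_K[of 1] by (auto intro!: K_intros)
  qed
  have \<tau>K2: "\<tau> a \<in> K 2" if a: "a \<in> K 2" for a
  proof -
    obtain p q where pq: "p \<in> K 1" "q \<in> K 1" "a = p + q * y" using a unfolding K2 by (rule adjE)
    then have "\<tau> a = \<tau> p + \<tau> q * (z / y)"
      using \<tau>_mult[of q y] \<tau>_add[of p "q * y"] inL[of _ 1] yL \<tau>y by (auto intro!: K_intros)
    then show ?thesis using pq \<tau>K1 K_mono[of 1 2] yK(1) zK by (auto intro!: K_intros)
  qed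

  define v where "v = x 3"
  \<comment> \<open>The bound \<open>2 \<le> n\<close> serves to place \<open>x 3\<close> in the
    domain of \<open>\<tau>\<close>.\<close>
  have vL: "v \<in> K (Suc n)" using xL[of 3] n by (simp add: v_def)
  have v2: "v\<^sup>2 = ?\<nu> + y" unfolding v_def y using x_Suc_sq[of 2] by (simp add: eval_nat_numeral)
  have vK: "v \<notin> K 2" using x_Suc_notin[of 2] by (simp add: v_def eval_nat_numeral)
  have v0: "v \<noteq> 0" using vK subfield_zero[OF subfield_K] by auto
  have \<tau>v2: "(\<tau> v)\<^sup>2 = ?\<nu> + z / y"
    using \<tau>_sq[OF vL] \<tau>_add[OF \<nu>L yL] \<tau>_int \<tau>y by (simp add: v2)
  define w where "w = v * \<tau> v"
  have wL: "w \<in> K (Suc n)" unfolding w_def using vL \<tau>(2) by (auto intro!: K_intros)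
  have \<tau>w: "\<tau> w = w" unfolding w_def using vL \<tau>(2,3) by (simp add: \<tau>_mult mult.commute)
  have w2: "w\<^sup>2 = (?\<nu> + y) * (?\<nu> + z / y)" unfolding w_def power_mult_distrib v2 \<tau>v2 ..
  have w2K: "w\<^sup>2 \<in> K 2" unfolding w2 using yK(1) zK by (auto intro!: K_intros)
  have wK: "w \<in> K 2"
  proof (rule ccontr)
    assume w: "w \<notin> K 2"
    show False
    proof (cases "w \<in> K 3")
      case True
      then have "w \<in> adj (K 2) v" using K_Suc[of 2] by (simp add: v_def eval_nat_numeral)
      then obtain b where b: "b \<in> K 2" "w = b * v"
        using square_in_base_imp_multiple[of "K 2" v w] w w2K vK subfield_K v2 yK(1)
        by (metis subfield_add subfield_of_int)
      \<comment> \<open>Thus \<open>\<tau> v\<close> lies in \<open>K 2\<close>; as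
        \<open>\<tau>\<close> is an involution preserving \<open>K 2\<close>, so does
        \<open>v\<close>.\<close>
      then have "\<tau> v = b" using v0 by (simp add: w_def)
      then have "v \<in> K 2" using \<tau>K2[OF b(1)] \<tau>(3)[OF vL] by simp
      then show False using vK by simp
    next
      case False
      then show False using new_sqrt_imp_bottom[OF wL, of 2] w2K by (simp add: eval_nat_numeral)
    qed
  qed
  then obtain p q where pq: "p \<in> K 1" "q \<in> K 1" "w = p + q * y" unfolding K2 by (rule adjE)
  have pqL: "p \<in> K (Suc n)" "q \<in> K (Suc n)" "\<tau> p \<in> K 1" "\<tau> q \<in> K 1"
    using pq inL[of _ 1] \<tau>K1 by auto
  define N where "N = p\<^sup>2 - q\<^sup>2 * y\<^sup>2"
  have N1: "N \<in> K 1" using pq y2' by (auto simp: N_def intro!: K_intros)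
  text \<open>\<open>\<tau>\<close> commutes with \<open>y \<mapsto> - y\<close> on \<open>K\<^sub>2\<close>, hence it fixes the norm of \<open>w\<close>.\<close>
  have conj: "p - q * y = \<tau> p - \<tau> q * (z / y)"
  proof -
    have "p + q * y = \<tau> p + \<tau> q * (z / y)"
      using \<tau>w \<tau>_mult[of q y] \<tau>_add[of p "q * y"] pq pqL yL \<tau>y by (auto intro!: K_intros)
    also have "\<dots> = \<tau> p + (\<tau> q * z / y\<^sup>2) * y" using y0 by (simp add: power2_eq_square)
    finally have eq: "p = \<tau> p \<and> q = \<tau> q * z / y\<^sup>2"
      using adj_coords_unique[OF subfield_K y2' yK(2)] pq pqL zK y2'
      by (metis subfield_divide[OF subfield_K] subfield_mult[OF subfield_K])
    then have "q * y = \<tau> q * z / y\<^sup>2 * y" by metis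
    also have "\<dots> = \<tau> q * (z / y)" using y0 by (simp add: power2_eq_square)
    finally show ?thesis using eq by metis
  qed
  have \<tau>N: "\<tau> N = N"
  proof -
    have wN: "N = w * (p + (- q) * y)" unfolding N_def pq by (simp add: algebra_simps power2_eq_square)
    have mq: "\<tau> (- q) = - \<tau> q" using \<tau>_mult[of "-1" q] \<tau>_Rats[of "-1"] pqL by (auto intro!: K_intros)
    have "\<tau> (p + (- q) * y) = \<tau> p - \<tau> q * (z / y)"
      using \<tau>_mult[of "- q" y] \<tau>_add[of p "(- q) * y"] pqL yL \<tau>y mq
        subfield_mult[OF subfield_K, of "- q" "Suc n" y] subfield_uminus[OF subfield_K, of q "Suc n"]
      by simp
    also have "\<dots> = p + (- q) * y" using conj by simp
    finally show ?thesis
      using \<tau>_mult[OF wL, of "p + (- q) * y"] \<tau>w wN pqL yL by (auto intro!: K_intros)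
  qed
  obtain a b where ab: "a \<in> K 0" "b \<in> K 0" "N = a + b * x 1" using N1 unfolding K1 by (rule adjE)
  \<comment> \<open>\<open>\<tau>\<close> fixes \<open>N\<close> but negates \<open>x 1\<close>,
    since \<open>i = 0\<close>.\<close>
  have "N = a - b * x 1"
    using \<tau>N ab \<tau>_mult[of b "x 1"] \<tau>_add[of a "b * x 1"] inL[of _ 0] xL[of 1] \<tau>(4,5) i0
    by (auto intro!: K_intros)
  then have "N = a" using ab by (simp add: eq_neg_iff_add_eq_0 flip: mult_2)
  then have NQ: "N \<in> \<rat>" using ab(1) unfolding K_0 by (rule ssubst)
  define u where "u = z / y\<^sup>2"
  have u: "z / y = u * y" "z = u * y\<^sup>2" using y0 by (auto simp: u_def power2_eq_square)
  have uK: "u \<in> K 1" unfolding u_def using y2' zK by (auto intro!: K_intros)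
  have "w\<^sup>2 * (p - q * y)\<^sup>2 = N\<^sup>2" unfolding N_def pq by (simp add: algebra_simps power2_eq_square)
  \<comment> \<open>The conjugate under \<open>y \<mapsto> - y\<close> of the formula for
    \<open>w\<^sup>2\<close>, obtained by comparing coordinates.\<close>
  moreover have "(p - q * y)\<^sup>2 = (?\<nu> - y) * (?\<nu> - u * y)"
  proof -
    have "(p\<^sup>2 + q\<^sup>2 * y\<^sup>2) + (2 * p * q) * y = w\<^sup>2" unfolding pq by (simp add: algebra_simps power2_eq_square)
    also have "w\<^sup>2 = (?\<nu>\<^sup>2 + u * y\<^sup>2) + (?\<nu> * (1 + u)) * y"
      unfolding w2 u(1) by (simp add: algebra_simps power2_eq_square)
    finally have "p\<^sup>2 + q\<^sup>2 * y\<^sup>2 = ?\<nu>\<^sup>2 + u * y\<^sup>2 \<and> 2 * p * q = ?\<nu> * (1 + u)"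
      by (intro adj_coords_unique[OF subfield_K y2' yK(2)])
        (use pq uK y2' in \<open>auto intro!: K_intros\<close>)
    then have "(p\<^sup>2 + q\<^sup>2 * y\<^sup>2) - (2 * p * q) * y = (?\<nu>\<^sup>2 + u * y\<^sup>2) - (?\<nu> * (1 + u)) * y" by simp
    then show ?thesis by (simp add: algebra_simps power2_eq_square)
  qed
  moreover have "(?\<nu> + y) * (?\<nu> + u * y) * ((?\<nu> - y) * (?\<nu> - u * y)) =
      ?\<nu> ^ 4 - ?\<nu>\<^sup>2 * (y\<^sup>2 + (u * y)\<^sup>2) + (u * y\<^sup>2)\<^sup>2"
    by (simp add: algebra_simps power2_eq_square power4_eq_xxxx)
  \<comment> \<open>\<open>u * y\<close> is \<open>\<tau> y\<close>, so the two squares are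
    \<open>\<nu> + x 1\<close> and \<open>\<nu> - x 1\<close>.\<close>
  moreover have "y\<^sup>2 + (u * y)\<^sup>2 = 2 * ?\<nu>" using y2 \<tau>y2 \<tau>y u(1) by simp
  ultimately have "N\<^sup>2 = ?\<nu> ^ 4 - ?\<nu>\<^sup>2 * (2 * ?\<nu>) + (?\<nu>\<^sup>2 - ?\<nu> - x 0)"
    using w2 z2 i0 u by simp
  also have "\<dots> = of_int (iter_norm \<nu> 1 - x0)"
    by (simp add: x_0 algebra_simps power2_eq_square power4_eq_xxxx)
  finally show False using iter_norm_nonsquare[of 1 N] NQ by simp
qed

text \<open>
  Adjoining \<open>x\<^sub>1, x\<^sub>2, \<dots>\<close> to \<open>F\<close> one by one, the last proper step before \<open>K\<^bsub>n+1\<^esub>\<close> is reached would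
  produce an involution excluded by \<open>no_involution\<close>.
\<close>

lemma subfield_eq_K:
  assumes n: "2 \<le> n" and F: "subfield F CC" "F \<subseteq> K (Suc n)" "\<not> F \<subseteq> K n"
  shows "F = K (Suc n)"
proof -
  \<comment> \<open>\<open>E i\<close> is the compositum of \<open>F\<close> and
    \<open>K i\<close>.\<close>
  define E where "E = rec_nat F (\<lambda>i e. adj e (x (Suc i)))"
  have E_0: "E 0 = F" and E_Suc: "E (Suc i) = adj (E i) (x (Suc i))" for i
    by (simp_all add: E_def)
  have E: "subfield (E i) CC \<and> K i \<subseteq> E i \<and> F \<subseteq> E i" for i
  proof (induction i)
    case 0
    then show ?case using F(1) Rats_subset_subfield[OF F(1)] by (simp add: E_0 K_0)
  next
    case (Suc i)
    then have *: "subfield (E i) CC" "(x (Suc i))\<^sup>2 \<in> E i" using x_Suc_sq_in by auto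
    have "K (Suc i) \<subseteq> E (Suc i)"
      unfolding K_Suc E_Suc
      using adj_subset[OF subfield_K x_Suc_sq_in subfield_adj[OF *]] gen_in_adj[OF *] subset_adj[OF *] Suc
      by blast
    then show ?case using subfield_adj[OF *] subset_adj[OF *] Suc by (auto simp: E_Suc)
  qed
  have E_sq: "(x (Suc i))\<^sup>2 \<in> E i" for i using E x_Suc_sq_in by blast
  have E_sub: "E i \<subseteq> K (Suc n)" if "i \<le> Suc n" for i
    using that
  proof (induction i)
    case 0
    then show ?case using F by (simp add: E_0)
  next
    case (Suc i)
    have "E i \<subseteq> K (Suc n)" "x (Suc i) \<in> K (Suc n)"
      using Suc x_in_K[of "Suc i"] K_mono[of "Suc i" "Suc n"] by auto
    then show ?case
      unfolding E_Suc by (rule adj_subset[OF conjunct1[OF E] E_sq subfield_K])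
  qed
  have "E n = K (Suc n)"
  proof
    \<comment> \<open>An element of \<open>F\<close> outside \<open>K n\<close> can be solved for
      \<open>x (Suc n)\<close>, so \<open>F\<close> and \<open>K n\<close> together generate
      \<open>K (Suc n)\<close>.\<close>
    obtain y where y: "y \<in> F" "y \<notin> K n" using F(3) by auto
    then have "y \<in> K (Suc n)" using F(2) by auto
    then obtain a b where ab: "a \<in> K n" "b \<in> K n" "y = a + b * x (Suc n)" by (rule K_SucE)
    have "b \<noteq> 0" using ab y(2) by auto
    then have x: "x (Suc n) = (y - a) / b" using ab by simp
    have "y \<in> E n" "a \<in> E n" "b \<in> E n" using E[of n] ab(1,2) y(1) by auto
    then have "x (Suc n) \<in> E n" unfolding x using E[of n] by (intro subfield_divide subfield_diff) auto
    then show "K (Suc n) \<subseteq> E n"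
      unfolding K_Suc using adj_subset[OF subfield_K x_Suc_sq_in] E by blast
  qed (use E_sub in auto)
  define j where "j = (LEAST i. E i = K (Suc n))"
  have j: "E j = K (Suc n)" unfolding j_def using \<open>E n = K (Suc n)\<close> by (rule LeastI)
  have jn: "j \<le> n" unfolding j_def using \<open>E n = K (Suc n)\<close> by (rule Least_le)
  have least: "E i \<noteq> K (Suc n)" if "i < j" for i using that not_less_Least unfolding j_def by blast
  show ?thesis
  proof (cases j)
    case 0
    then show ?thesis using j E_0 by simp
  next
    case (Suc i)
    have L: "adj (E i) (x (Suc i)) = K (Suc n)" using j Suc E_Suc by simp
    have "x (Suc i) \<notin> E i"
    proof
      assume "x (Suc i) \<in> E i"
      then have "K (Suc n) \<subseteq> E i" using adj_subset[OF _ E_sq, of i "E i"] E L by blast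
      then show False using least[of i] E_sub[of i] jn Suc by auto
    qed
    then obtain \<tau> where \<tau>: "\<tau> \<in> ring_hom (CC\<lparr>carrier := K (Suc n)\<rparr>) CC"
        "\<And>y. y \<in> K (Suc n) \<Longrightarrow> \<tau> y \<in> K (Suc n)" "\<And>y. y \<in> K (Suc n) \<Longrightarrow> \<tau> (\<tau> y) = y"
        "\<And>y. y \<in> E i \<Longrightarrow> \<tau> y = y" "\<tau> (x (Suc i)) = - x (Suc i)"
      using quadratic_conj_exists[of "E i" "x (Suc i)"] E E_sq unfolding L by metis
    have "\<tau> y = y" if "y \<in> K i" for y using that \<tau>(4) E[of i] by blast
    then have False using no_involution[OF n _ \<tau>(1-3) _ \<tau>(5)] jn Suc by simp
    then show ?thesis ..
  qed
qed

text \<open>\<open>F\<close> has elements first appearing at arbitrarily high levels; by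
  \<open>subfield_eq_K\<close> it contains each of these levels entirely.\<close>

lemma unbounded_subfield_eq_Union:
  assumes F: "subfield F CC" "F \<subseteq> (\<Union>n. K n)" and unbounded: "\<And>m. \<not> F \<subseteq> K m"
  shows "F = (\<Union>n. K n)"
proof
  show "(\<Union>n. K n) \<subseteq> F"
  proof (rule UN_least)
    fix m
    \<comment> \<open>The maximum ensures both \<open>2 \<le> r\<close> and
      \<open>K m \<subseteq> K (Suc r)\<close>.\<close>
    obtain y where y: "y \<in> F" "y \<notin> K (max m 2)" using unbounded by blast
    then obtain n where "y \<in> K n" using F(2) by auto
    then obtain r where r: "max m 2 \<le> r" "y \<in> K (Suc r)" "y \<notin> K r" using y(2) by (rule entry_level)
    have "subfield (F \<inter> K (Suc r)) CC"
      by (rule subfield_CC_I) (auto intro!: subfield_intros[OF F(1)] K_intros)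
    then have "F \<inter> K (Suc r) = K (Suc r)" using subfield_eq_K[of r] r y(1) by auto
    then show "K m \<subseteq> F" using K_mono[of m "Suc r"] r(1) by auto
  qed
qed (rule F(2))

text \<open>\<open>subfield_eq_K\<close> is applied at the least level containing \<open>F\<close>.
  Levels up to 2 are out of its reach, since \<open>K 2\<close> may have several quadratic
  subfields.\<close>

lemma bounded_subfield_cases:
  assumes F: "subfield F CC" "F \<subseteq> K m"
  obtains "F \<subseteq> K 2" | n where "F = K n"
proof (cases "F \<subseteq> K 2")
  case False
  define l where "l = (LEAST i. F \<subseteq> K i)"
  have l: "F \<subseteq> K l" unfolding l_def using F(2) by (rule LeastI)
  have "2 < l" using l False K_mono[of l 2] by (meson not_le_imp_less subset_trans)
  moreover have "\<not> F \<subseteq> K (l - 1)" using not_less_Least[of "l - 1" "\<lambda>i. F \<subseteq> K i"] \<open>2 < l\<close> by (simp add: l_def)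
  ultimately have "F = K (Suc (l - 1))" using subfield_eq_K[of "l - 1" F] F(1) l by auto
  then show ?thesis using that by blast
qed (use that in blast)

end

section \<open>Conjugating the whole tower\<close>

text \<open>Realises another choice of signs as a conjugate tower: homomorphisms are extended one
  quadratic step at a time and glued on the union.\<close>

lemma (in sqrt_tower) ring_hom_exists:
  assumes x'_0: "x' 0 = of_int x0" and x'_Suc: "\<And>n. (x' (Suc n))\<^sup>2 = of_int \<nu> + x' n"
  obtains h where "h \<in> ring_hom (CC\<lparr>carrier := \<Union>n. K n\<rparr>) CC" "\<And>n. h (x n) = x' n"
proof -
  define H where "H = rec_nat (\<lambda>a. a) (\<lambda>n h. ext h (K n) (x (Suc n)) (x' (Suc n)))"
  have H_0: "H 0 = (\<lambda>a. a)" and H_Suc: "H (Suc n) = ext (H n) (K n) (x (Suc n)) (x' (Suc n))" for n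
    by (simp_all add: H_def)
  have hom_0: "f 0 = 0" "f 1 = 1" if "f \<in> ring_hom (CC\<lparr>carrier := K n\<rparr>) CC" for f n
  proof -
    have "f (0 + 0) = f 0 + f 0" "f 1 = 1"
      using that subfield_zero[OF subfield_K] unfolding ring_hom_CC_iff by blast+
    then show "f 0 = 0" "f 1 = 1" by simp_all
  qed
  have H: "H n \<in> ring_hom (CC\<lparr>carrier := K n\<rparr>) CC \<and> H n (x n) = x' n \<and> (\<forall>i. H n (of_int i) = of_int i)" for n
  proof (induction n)
    case 0
    then show ?case by (simp add: H_0 x_0 x'_0 ring_hom_CC_iff)
  next
    case (Suc n)
    then have hom: "H n \<in> ring_hom (CC\<lparr>carrier := K n\<rparr>) CC" by simp
    have "H n (of_int \<nu> + x n) = of_int \<nu> + x' n"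
      using Suc x_in_K subfield_of_int[OF subfield_K] by (auto simp: ring_hom_CC_iff)
    then have sq: "(x' (Suc n))\<^sup>2 = H n ((x (Suc n))\<^sup>2)" by (simp add: x'_Suc x_Suc_sq)
    note facts = subfield_K[of n] x_Suc_sq_in[of n] x_Suc_notin[of n]
    show ?case
      unfolding H_Suc using ring_hom_ext[OF facts hom sq] ext_gen[where h = "H n", OF facts hom_0[OF hom]]
        ext_base[where h = "H n", OF facts hom_0(1)[OF hom]] Suc subfield_of_int[OF subfield_K]
      by (auto simp: K_Suc)
  qed
  have H_ext: "H n y = H m y" if "m \<le> n" "y \<in> K m" for m n y
    using that(1)
  proof (induction n rule: dec_induct)
    case (step n)
    then have y: "y \<in> K n" using that(2) K_mono by blast
    have "H n 0 = 0" using hom_0(1) H by blast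
    from ext_base[where h = "H n", OF subfield_K[of n] x_Suc_sq_in[of n] x_Suc_notin[of n] this y] show ?case
      using step by (simp add: H_Suc)
  qed simp
  define h where "h y = H (LEAST n. y \<in> K n) y" for y
  have h: "h y = H n y" if "y \<in> K n" for y n
    unfolding h_def using H_ext[of "LEAST n. y \<in> K n" n y] that
    by (metis LeastI Least_le)
  show ?thesis
  proof (rule that)
    have "h (a * b) = h a * h b \<and> h (a + b) = h a + h b" if "a \<in> K m" "b \<in> K n" for a b m n
    proof -
      have ab: "a \<in> K (max m n)" "b \<in> K (max m n)" using that K_mono[of m "max m n"] K_mono[of n "max m n"] by auto
      then have "a * b \<in> K (max m n)" "a + b \<in> K (max m n)" by (auto intro!: K_intros)
      then show ?thesis using ab H[of "max m n"] by (simp add: h[of _ "max m n"] ring_hom_CC_iff)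
    qed
    moreover have "h 1 = 1" using h[of 1 0] by (simp add: H_0 K_0)
    ultimately show "h \<in> ring_hom (CC\<lparr>carrier := \<Union>n. K n\<rparr>) CC" by (auto simp: ring_hom_CC_iff)
    show "h (x n) = x' n" for n using h[OF x_in_K] H by simp
  qed
qed

section \<open>Arithmetic of the iterated norms\<close>

text \<open>For \<open>2 \<le> \<nu>\<close> the value \<open>\<nu>\<^sup>2 - \<nu>\<close> is at
  least \<open>\<nu>\<close>, so squaring and subtracting \<open>\<nu>\<close> cannot go below
  it.\<close>

lemma iter_norm_ge:
  assumes "2 \<le> \<nu>"
  shows "\<nu>\<^sup>2 - \<nu> \<le> iter_norm \<nu> k"
proof (induction k)
  case (Suc k)
  have \<nu>: "\<nu> \<le> \<nu>\<^sup>2 - \<nu>" using mult_right_mono[of 2 \<nu> \<nu>] assms by (simp add: power2_eq_square)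
  then have "\<nu>\<^sup>2 \<le> (iter_norm \<nu> k)\<^sup>2" using Suc assms by (intro power_mono) auto
  then show ?case by simp
qed simp

lemma rational_sqrt_of_int:
  fixes r :: complex
  assumes "r \<in> \<rat>" "r\<^sup>2 = of_int N"
  obtains y where "y\<^sup>2 = N"
proof -
  have "algebraic_int r"
    by (rule algebraic_int_root[where p = "monom 1 2" and y = "of_int N"])
      (use assms in \<open>auto simp: poly_monom degree_monom_eq\<close>)
  then have "r \<in> \<int>" using assms(1) by (rule rational_algebraic_int_is_int)
  then obtain y where "r = of_int y" by (auto elim: Ints_cases)
  then have "of_int (y\<^sup>2) = (of_int N :: complex)" using assms(2) by simp
  then show ?thesis using that of_int_eq_iff by blast
qed

lemma iter_norm_minus_nonsquare:
  assumes \<nu>: "2 \<le> \<nu>" and x0: "0 \<le> x0" "x0 < \<nu>\<^sup>2 - \<nu>" and ne: "(\<nu>, x0) \<noteq> (2, 1)" and m: "1 \<le> m"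
  shows "y\<^sup>2 \<noteq> iter_norm \<nu> m - x0"
proof
  assume y: "y\<^sup>2 = iter_norm \<nu> m - x0"
  define c where "c = iter_norm \<nu> (m - 1)"
  have c: "\<nu>\<^sup>2 - \<nu> \<le> c" unfolding c_def by (rule iter_norm_ge[OF \<nu>])
  have "iter_norm \<nu> m = c\<^sup>2 - \<nu>" using m by (cases m) (auto simp: c_def)
  then have y2: "\<bar>y\<bar>\<^sup>2 = c\<^sup>2 - (\<nu> + x0)" using y by simp
  then have "\<bar>y\<bar>\<^sup>2 < c\<^sup>2" using \<nu> x0 by simp
  moreover have "0 \<le> c" using c x0 by linarith
  ultimately have "\<bar>y\<bar> < c" by (rule power2_less_imp_less)
  then have "\<bar>y\<bar>\<^sup>2 \<le> (c - 1)\<^sup>2" by (intro power_mono) auto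
  then have "2 * c - 1 \<le> \<nu> + x0" using y2 by (simp add: power2_eq_square algebra_simps)
  with c have *: "2 * \<nu>\<^sup>2 - 2 * \<nu> - 1 \<le> \<nu> + x0" by linarith
  \<comment> \<open>Together with \<open>x0 < \<nu>\<^sup>2 - \<nu>\<close> this leaves
    \<open>\<nu> = 2\<close>, where the bounds give the excluded \<open>x0 = 1\<close>.\<close>
  with x0 have "\<nu>\<^sup>2 \<le> 2 * \<nu>" by linarith
  then have "\<nu> = 2" using \<nu> by (simp add: power2_eq_square)
  then show False using * x0 ne by simp
qed

section \<open>Dimensions\<close>

lemma dimension_subspace:
  assumes k: "subfield k CC" and "ring.dimension CC m k E" "ring.dimension CC n k E'" "E \<subseteq> E'"
  shows "m \<le> n" and "m = n \<Longrightarrow> E = E'"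
proof -
  obtain Vs where Vs: "set Vs \<subseteq> carrier CC" "CC.independent k Vs" "length Vs = m" "CC.Span k Vs = E"
    using CC.exists_base[OF k assms(2)] by blast
  have "set Vs \<subseteq> E'" using CC.Span_base_incl[OF k Vs(1)] Vs(4) assms(4) by blast
  then show "m \<le> n" "m = n \<Longrightarrow> E = E'"
    using CC.independent_length_le_dimension[OF k assms(3) Vs(2)]
      CC.independent_length_eq_dimension[OF k assms(3) Vs(2)] Vs(3,4) by auto
qed

lemma finite_dimension_subfield:
  assumes "subfield F CC" "F \<subseteq> E" "ring.finite_dimension CC \<rat> E"
  shows "ring.finite_dimension CC \<rat> F"
proof (rule CC.subalbegra_incl_imp_finite_dimension[OF subfield_Rats assms(3) _ assms(2)])
  show "subalgebra \<rat> F CC"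
    using subring.axioms(1)[OF subfieldE(1)[OF assms(1)]] Rats_subset_subfield[OF assms(1)]
    by (auto intro!: subalgebra.intro subfield_mult[OF assms(1)] simp: subalgebra_axioms_def)
qed

section \<open>The fields \<open>K\<^sub>n\<close>\<close>

lemma subfield_tower_field: "subfield (tower_field s \<nu> x0 n) CC"
  unfolding tower_field_def by (rule field.generate_field_is_subfield[OF field_CC]) simp

lemma tower_field_eqI:
  assumes "subfield E CC" "tower_elt s \<nu> x0 n \<in> E"
    "\<And>F. subfield F CC \<Longrightarrow> tower_elt s \<nu> x0 n \<in> F \<Longrightarrow> E \<subseteq> F"
  shows "tower_field s \<nu> x0 n = E"
  unfolding tower_field_def
  by (rule field.generate_fieldI[OF field_CC, symmetric]) (use assms Rats_subset_subfield in auto)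

lemma tower_elt_in: "tower_elt s \<nu> x0 n \<in> tower_field s \<nu> x0 n"
  unfolding tower_field_def by (rule generate_field.incl) simp

lemma tower_field_least:
  "subfield F CC \<Longrightarrow> tower_elt s \<nu> x0 n \<in> F \<Longrightarrow> tower_field s \<nu> x0 n \<subseteq> F"
  unfolding tower_field_def
  by (rule field.generate_field_min_subfield1[OF field_CC]) (use Rats_subset_subfield in auto)

lemma tower_elt_sq: "(tower_elt s \<nu> x0 (Suc n))\<^sup>2 = of_int \<nu> + tower_elt s \<nu> x0 n"
  by simp

lemma sqrt_tower_of_dimension:
  assumes dim: "\<And>n. ring.dimension CC 2 (tower_field s \<nu> x0 n) (tower_field s \<nu> x0 (Suc n))"
  shows "sqrt_tower \<nu> x0 (tower_elt s \<nu> x0) (tower_field s \<nu> x0)"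
proof
  let ?x = "tower_elt s \<nu> x0" and ?K = "tower_field s \<nu> x0"
  show "?x 0 = of_int x0" by simp
  show "(?x (Suc n))\<^sup>2 = of_int \<nu> + ?x n" for n by (rule tower_elt_sq)
  show "?K 0 = \<rat>" by (rule tower_field_eqI) (use subfield_Rats Rats_subset_subfield in auto)
  show K_Suc: "?K (Suc n) = adj (?K n) (?x (Suc n))" for n
  proof (rule tower_field_eqI)
    have sq: "(?x (Suc n))\<^sup>2 \<in> ?K n"
      unfolding tower_elt_sq by (intro subfield_intros subfield_tower_field tower_elt_in)
    show "subfield (adj (?K n) (?x (Suc n))) CC" "?x (Suc n) \<in> adj (?K n) (?x (Suc n))"
      using subfield_adj[OF subfield_tower_field sq] gen_in_adj[OF subfield_tower_field sq] .
    fix F assume F: "subfield F CC" "?x (Suc n) \<in> F"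
    \<comment> \<open>The previous generator is a polynomial in the new one, so a field containing
      \<open>?x (Suc n)\<close> contains \<open>?K n\<close>.\<close>
    have "?x n = (?x (Suc n))\<^sup>2 - of_int \<nu>" unfolding tower_elt_sq by simp
    also have "\<dots> \<in> F" using F by (intro subfield_intros)
    finally show "adj (?K n) (?x (Suc n)) \<subseteq> F"
      using adj_subset[OF subfield_tower_field sq F(1) tower_field_least] F by blast
  qed
  show "?x (Suc n) \<notin> ?K n" for n
  proof
    assume x: "?x (Suc n) \<in> ?K n"
    then have "adj (?K n) (?x (Suc n)) \<subseteq> ?K n"
      by (intro adj_subset subfield_tower_field subfield_power) auto
    moreover have "?K n \<subseteq> adj (?K n) (?x (Suc n))"
      using x by (intro subset_adj subfield_tower_field subfield_power)
    ultimately have "ring.dimension CC 2 (?K n) (?K n)" using dim[of n] K_Suc by simp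
    then show False
      using CC.dimension_is_inj[OF subfield_tower_field _ CC.dimension_one[OF subfield_tower_field]] by force
  qed
qed

text \<open>Total reality enters the argument here: equality would make the first square root
  rational, and a larger \<open>x0\<close> would give a non-real conjugate.\<close>

lemma totally_real_imp_bound:
  assumes tower: "sqrt_tower \<nu> x0 (tower_elt s \<nu> x0) (tower_field s \<nu> x0)"
    and real: "totally_real (tower_union s \<nu> x0)" and "2 \<le> \<nu>" "0 \<le> x0"
  shows "x0 < \<nu>\<^sup>2 - \<nu>"
proof (rule ccontr)
  interpret sqrt_tower \<nu> x0 "tower_elt s \<nu> x0" "tower_field s \<nu> x0" by (rule tower)
  assume "\<not> x0 < \<nu>\<^sup>2 - \<nu>"
  then consider "x0 = \<nu>\<^sup>2 - \<nu>" | "\<nu>\<^sup>2 < \<nu> + x0" by linarith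
  then show False
  proof cases
    case 1
    then have "(tower_elt s \<nu> x0 1)\<^sup>2 = (of_int \<nu>)\<^sup>2" using x_Suc_sq[of 0] x_0 by simp
    then have "tower_elt s \<nu> x0 1 = of_int \<nu> \<or> tower_elt s \<nu> x0 1 = - of_int \<nu>" by (simp only: power2_eq_iff)
    then show False using x_Suc_notin[of 0] by (auto simp: K_0)
  next
    case 2
    text \<open>Conjugate so that \<open>x\<^sub>1\<close> becomes negative; then \<open>\<nu> + x\<^sub>1 < 0\<close>.\<close>
    define x' where "x' = tower_elt (s(0 := False)) \<nu> x0"
    obtain h where h: "h \<in> ring_hom (CC\<lparr>carrier := tower_union s \<nu> x0\<rparr>) CC"
      "\<And>n. h (tower_elt s \<nu> x0 n) = x' n"
      using ring_hom_exists[of x'] by (auto simp: x'_def tower_union_def simp del: tower_elt.simps(2) simp add: tower_elt_sq)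
    have "tower_elt s \<nu> x0 2 \<in> tower_union s \<nu> x0" using x_in_K by (auto simp: tower_union_def)
    then have "x' 2 \<in> \<real>" using real h by (force simp: totally_real_def)
    then obtain t where t: "x' 2 = of_real t" by (auto elim: Reals_cases)
    \<comment> \<open>Sign number \<open>0\<close> belongs to \<open>x' 1\<close>, and
      \<open>csqrt\<close> of a nonnegative real is the usual root.\<close>
    have "x' 1 = - of_real (sqrt (of_int (\<nu> + x0)))"
      using assms(3,4) csqrt_of_real_nonneg[of "of_int (\<nu> + x0)"] by (simp add: x'_def)
    moreover have "(x' 2)\<^sup>2 = of_int \<nu> + x' 1"
      unfolding x'_def using tower_elt_sq[of _ _ _ 1] by (simp only: numeral_2_eq_2 One_nat_def)
    ultimately have "of_real (t\<^sup>2) = (of_real (of_int \<nu> - sqrt (of_int (\<nu> + x0))) :: complex)"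
      unfolding t by simp
    then have "t\<^sup>2 = of_int \<nu> - sqrt (of_int (\<nu> + x0))" by (simp only: of_real_eq_iff)
    moreover have "real_of_int \<nu> < sqrt (of_int (\<nu> + x0))"
      by (rule real_less_rsqrt) (use 2 in \<open>metis of_int_less_iff of_int_power\<close>)
    ultimately show False using zero_le_power2[of t] by linarith
  qed
qed

theorem theorem5p3:
  fixes s :: "nat \<Rightarrow> bool" and \<nu> x0 :: int
  assumes "(\<nu>, x0) \<in> Omega1 s"
    and "(\<nu>, x0) \<noteq> (2, 1)"
  shows "(\<forall>n\<ge>2. \<forall>F. (subfield F CC \<and> F \<subseteq> tower_union s \<nu> x0 \<and> ring.dimension CC (2 ^ n) \<rat> F)
                      \<longleftrightarrow> F = tower_field s \<nu> x0 n) \<and>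
         (\<forall>F. subfield F CC \<and> F \<subseteq> tower_union s \<nu> x0 \<and> \<not> ring.finite_dimension CC \<rat> F
              \<longrightarrow> F = tower_union s \<nu> x0)"
proof -
  let ?K = "tower_field s \<nu> x0"
  have \<nu>: "2 \<le> \<nu>" "0 \<le> x0" and real: "totally_real (tower_union s \<nu> x0)"
    and dim2: "\<And>n. ring.dimension CC 2 (?K n) (?K (Suc n))"
    using assms(1) by (auto simp: Omega1_def Omega_def)
  have tower: "sqrt_tower \<nu> x0 (tower_elt s \<nu> x0) ?K" using dim2 by (rule sqrt_tower_of_dimension)
  interpret sqrt_tower \<nu> x0 "tower_elt s \<nu> x0" ?K by (rule tower)
  have x0: "x0 < \<nu>\<^sup>2 - \<nu>" by (rule totally_real_imp_bound[OF tower real \<nu>])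
  interpret rigid_sqrt_tower \<nu> x0 "tower_elt s \<nu> x0" ?K
  proof
    fix m :: nat and r :: complex assume "1 \<le> m" "r \<in> \<rat>"
    then show "r\<^sup>2 \<noteq> of_int (iter_norm \<nu> m - x0)"
      using iter_norm_minus_nonsquare[OF \<nu> x0 assms(2)] rational_sqrt_of_int[of r] by blast
  qed
  have dim: "ring.dimension CC (2 ^ n) \<rat> (?K n)" for n
  proof (induction n)
    case 0
    then show ?case using CC.dimension_one[OF subfield_Rats] by (simp add: K_0)
  next
    case (Suc n)
    then show ?case
      using CC.telescopic_base[OF subfield_Rats subfield_K Suc dim2] by (simp add: mult.commute)
  qed
  have U: "tower_union s \<nu> x0 = (\<Union>n. ?K n)" by (simp add: tower_union_def)
  have "F = ?K n" if n: "2 \<le> n" and F: "subfield F CC" "F \<subseteq> tower_union s \<nu> x0"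
    "ring.dimension CC (2 ^ n) \<rat> F" for n F
  proof -
    \<comment> \<open>Otherwise \<open>F\<close> would be the whole union and contain
      \<open>?K (Suc n)\<close>, whose degree is too large.\<close>
    have "\<exists>m. F \<subseteq> ?K m"
    proof (rule ccontr)
      assume "\<not> ?thesis"
      then have "?K (Suc n) \<subseteq> F" using unbounded_subfield_eq_Union[OF F(1)] F(2) U by blast
      then have "(2::nat) ^ Suc n \<le> 2 ^ n" using dimension_subspace(1)[OF subfield_Rats dim F(3)] by blast
      then show False by simp
    qed
    then obtain m where "F \<subseteq> ?K m" ..
    with F(1) show ?thesis
    proof (cases rule: bounded_subfield_cases)
      case 1
      \<comment> \<open>Inside \<open>?K 2\<close> the degree leaves only \<open>n = 2\<close>, and
        equal dimensions force equality.\<close>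
      then have "(2::nat) ^ n \<le> 2 ^ 2" using dimension_subspace(1)[OF subfield_Rats F(3) dim] by blast
      then have "n = 2" using n power_increasing_iff[of "2::nat" n 2] by simp
      then show ?thesis using dimension_subspace(2)[OF subfield_Rats F(3) dim 1] by simp
    next
      case (2 l)
      then have "(2::nat) ^ n = 2 ^ l" using CC.dimension_is_inj[OF subfield_Rats F(3)] dim by blast
      then show ?thesis using 2 by simp
    qed
  qed
  moreover have "?K n \<subseteq> tower_union s \<nu> x0" for n by (auto simp: U)
  moreover have "F = tower_union s \<nu> x0"
    if F: "subfield F CC" "F \<subseteq> tower_union s \<nu> x0" "\<not> ring.finite_dimension CC \<rat> F" for F
  proof -
    have "\<not> F \<subseteq> ?K m" for m
      using finite_dimension_subfield[OF F(1)] F(3) CC.finite_dimensionI[OF dim] by blast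
    then show ?thesis using unbounded_subfield_eq_Union[OF F(1)] F(2) U by simp
  qed
  ultimately show ?thesis using subfield_K dim by metis
qed

end
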